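(* Let $p$ be any prime and let $a$ be a positive integer. For any positive integer $n$ with $p\nmid n$, we have $$\sum_{k=1}^{p^a-1}\frac{B_k}{(-n)^k}\equiv a(-1)^{n-1}D_{n-1}\pmod{p},$$ where $B_k$ denotes the $k$-th Bell number and $D_m$ the $m$-th derangement number.
   Context: The Bell numbers are defined by $B_0=1$ and, for $k\ge 1$, $B_k$ is the number of partitions of a set of cardinality $k$ (equivalently $\sum_{k\ge0}B_kx^k/k!=e^{e^x-1}$). The derangement numbers are $D_0=1$ and, for $m\ge1$, $D_m$ is the number of permutations $\pi$ of $\{1,\dots,m\}$ with $\pi(k)\ne k$ for all $k$; equivalently $D_m=m!\sum_{k=0}^m(-1)^k/k!$. Since $p\nmid n$, the left-hand side is a $p$-adic integer (rational with denominator prime to $p$), and the congruence is understood in $\mathbb{Z}_p$ (the ring of $p$-adic integers). *)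

theory Defs
  imports Complex_Main "HOL-Library.Disjoint_Sets" "HOL-Combinatorics.Permutations"
    "HOL-Computational_Algebra.Primes"
begin

definition bell :: "nat \<Rightarrow> nat" where
  "bell k = card {P. partition_on {1..k} P}"

definition derangement_number :: "nat \<Rightarrow> nat" where
  "derangement_number m = card {\<pi>. \<pi> permutes {1..m} \<and> (\<forall>k\<in>{1..m}. \<pi> k \<noteq> k)}"

lemma bell_0: "bell 0 = 1"
proof -
  have "{P :: nat set set. partition_on {1..0} P} = {{}}"
    by (auto simp: partition_on_def)
  then show ?thesis by (simp add: bell_def)
qed

lemma derangement_number_0: "derangement_number 0 = 1"
  by (simp add: derangement_number_def)

text \<open>
  \<open>p_integral p x\<close> says that the rational \<open>x\<close> is a \<open>p\<close>-adic integer, using that the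
  rationals in \<open>\<int>\<^sub>p\<close> are those whose reduced denominator is prime to \<open>p\<close>. Since
  \<open>p\<int>\<^sub>p \<inter> \<rat>\<close> consists of \<open>p\<close> times such rationals, \<open>padic_cong\<close> is congruence modulo
  \<open>p\<int>\<^sub>p\<close> restricted to rational \<open>p\<close>-adic integers.
\<close>

definition p_integral :: "nat \<Rightarrow> rat \<Rightarrow> bool" where
  "p_integral p x \<longleftrightarrow> coprime (snd (quotient_of x)) (int p)"

definition padic_cong :: "nat \<Rightarrow> rat \<Rightarrow> rat \<Rightarrow> bool" where
  "padic_cong p x y \<longleftrightarrow> p_integral p x \<and> p_integral p y \<and>
     (\<exists>z. p_integral p z \<and> x - y = of_nat p * z)"

end

theory Submission
  imports Defs "HOL-Computational_Algebra.Polynomial"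
begin

text \<open>
  Let \<open>L\<close> be the linear functional on \<open>\<int>[x]\<close> with \<open>L(x\<^sup>k) = B\<^sub>k\<close>, and write \<open>q = p\<^sup>a\<close>. The recurrence
  of the Bell numbers says \<open>L(f(x+1)) = L(x f(x))\<close>, hence \<open>L(f(x+n)) = L((x)\<^sub>n f(x))\<close>, where
  \<open>(x)\<^sub>n = x(x-1)\<cdots>(x-n+1)\<close>. Modulo \<open>p\<close> the sum including \<open>k = 0\<close> is \<open>L\<close> applied to
  \<open>(x\<^sup>q - (-n)\<^sup>q)/(x + n) = (x+n)\<^bsup>q-1\<^esup>\<close>, so it equals \<open>L((x)\<^sub>n x\<^bsup>q-1\<^esup>) = L(x\<^sup>q (x-1)\<^bsub>n-1\<^esub>)\<close>.
  Since \<open>(x)\<^sub>p = x\<^sup>p - x\<close> modulo \<open>p\<close>, the variable satisfies \<open>x\<^sup>p = x + 1\<close> under \<open>L\<close>, hence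
  \<open>x\<^sup>q = x + a\<close>, and the value is \<open>L((x)\<^sub>n) + a L((x-1)\<^bsub>n-1\<^esub>) = 1 + a (-1)\<^bsup>n-1\<^esup> D\<^bsub>n-1\<^esub>\<close>.
\<close>

section \<open>Set partitions and the recurrence of the Bell numbers\<close>

lemma sum_Pow_card:
  fixes f :: "nat \<Rightarrow> 'b::comm_semiring_1"
  assumes "finite A"
  shows "(\<Sum>B\<in>Pow A. f (card B)) = (\<Sum>k\<le>card A. of_nat (card A choose k) * f k)"
proof -
  have "(\<Sum>B\<in>Pow A. f (card B)) = (\<Sum>k\<le>card A. \<Sum>B\<in>{B\<in>Pow A. card B = k}. f (card B))"
    using assms by (intro sum.group[symmetric]) (auto intro: card_mono)
  also have "\<dots> = (\<Sum>k\<le>card A. of_nat (card {B. B \<subseteq> A \<and> card B = k}) * f k)"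
    by (intro sum.cong) auto
  finally show ?thesis
    using assms by (simp add: n_subsets)
qed

text \<open>Delete the block containing \<open>x\<close>: what is left is a partition
  \<open>Q\<close> of some \<open>B\<close>, a subset of \<open>A\<close>, and the deleted block can
  only have been \<open>insert x (A - B)\<close>. So \<open>P\<close> and the pair
  \<open>(B, Q)\<close> determine each other.\<close>

lemma card_partition_on_insert:
  assumes "finite A" "x \<notin> A"
  shows "card {P. partition_on (insert x A) P} = (\<Sum>B\<in>Pow A. card {P. partition_on B P})"
proof -
  let ?F = "\<lambda>(B, Q). insert (insert x (A - B)) Q"
  let ?S = "SIGMA B:Pow A. {Q. partition_on B Q}"
  \<comment> \<open>Blocks of \<open>Q\<close> lie inside \<open>A\<close> and so miss
    \<open>x\<close>. Hence the block added by \<open>?F\<close> is new, which lets both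
    \<open>B\<close> and \<open>Q\<close> be recovered from the image.\<close>
  have notin: "insert x C \<notin> Q" if "partition_on B Q" "B \<subseteq> A" for B C Q
    using that assms by (auto simp: partition_on_def)
  have "bij_betw ?F ?S {P. partition_on (insert x A) P}"
    unfolding bij_betw_def
  proof
    show "inj_on ?F ?S"
    proof (rule inj_onI, clarify)
      fix B Q B' Q'
      assume *: "B \<subseteq> A" "partition_on B Q" "B' \<subseteq> A" "partition_on B' Q'"
        and eq: "insert (insert x (A - B)) Q = insert (insert x (A - B')) Q'"
      have "insert x (A - B) = insert x (A - B')"
        using eq notin[OF *(2,1)] notin[OF *(4,3)] by blast
      then have "A - B = A - B'"
        using assms by (auto simp: insert_ident)
      then have "B = B'"
        using * by blast
      moreover have "Q = Q'"
        using eq notin[OF *(2,1)] notin[OF *(4,3)] \<open>B = B'\<close> by (metis insert_ident)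
      ultimately show "B = B' \<and> Q = Q'" ..
    qed
    show "?F ` ?S = {P. partition_on (insert x A) P}"
    proof (intro equalityI subsetI)
      fix P assume "P \<in> ?F ` ?S"
      then obtain B Q where BQ: "B \<subseteq> A" "partition_on B Q" "P = insert (insert x (A - B)) Q"
        by auto
      have "disjnt (insert x (A - B)) (\<Union>Q)"
        using BQ assms by (auto simp: partition_on_def disjnt_def)
      moreover have "insert x A - insert x (A - B) = B"
        using BQ assms by auto
      ultimately show "P \<in> {P. partition_on (insert x A) P}"
        using BQ by (auto simp: partition_on_insert)
    next
      fix P assume "P \<in> {P. partition_on (insert x A) P}"
      then have P: "partition_on (insert x A) P" by simp
      then obtain X where X: "X \<in> P" "x \<in> X"
        by (auto simp: partition_on_def)
      let ?B = "insert x A - X"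
      have disj: "disjnt X (\<Union>(P - {X}))"
        using P X by (auto simp: partition_on_def disjoint_def disjnt_def)
      have P': "insert X (P - {X}) = P" using X by auto
      have "partition_on ?B (P - {X}) \<and> X \<subseteq> insert x A"
        using partition_on_insert[OF disj, of "insert x A"] P P' by auto
      moreover from this have "insert x (A - ?B) = X" "?B \<subseteq> A"
        using X by auto
      ultimately have "P = ?F (?B, P - {X})" "(?B, P - {X}) \<in> ?S"
        using P' by auto
      then show "P \<in> ?F ` ?S" by blast
    qed
  qed
  then have "card {P. partition_on (insert x A) P} = card ?S"
    by (metis bij_betw_same_card)
  also have "\<dots> = (\<Sum>B\<in>Pow A. card {P. partition_on B P})"
    using assms by (intro card_SigmaI) (auto intro: finitely_many_partition_on finite_subset)
  finally show ?thesis .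
qed

text \<open>Frees \<open>bell\<close> from the particular set \<open>{1..k}\<close>. No bijection is
  transported: \<open>A\<close> and \<open>{1..card A}\<close> each arise by adding one point to a
  set of the same size, and by induction both counts expand to the same sum.\<close>

lemma card_partition_on:
  fixes A :: "nat set"
  assumes "finite A"
  shows "card {P. partition_on A P} = bell (card A)"
  using assms
proof (induction "card A" arbitrary: A rule: less_induct)
  case less
  show ?case
  proof (cases "A = {}")
    case True
    have "{P. partition_on ({} :: nat set) P} = {{}}"
      by (auto simp: partition_on_empty)
    with True show ?thesis by (simp add: bell_0)
  next
    case False
    then obtain x A' where A: "A = insert x A'" "x \<notin> A'"
      by (meson Set.set_insert ex_in_conv)
    have fin: "finite A'" using A less.prems by simp
    have IH: "card {P. partition_on B P} = bell (card B)" if "finite B" "card B \<le> card A'" for B :: "nat set"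
      using that A fin by (intro less.hyps) auto
    have rec: "card {P. partition_on (insert y C) P} = (\<Sum>k\<le>card A'. (card A' choose k) * bell k)"
      if "finite C" "y \<notin> C" "card C = card A'" for y :: nat and C
    proof -
      have "card {P. partition_on (insert y C) P} = (\<Sum>B\<in>Pow C. bell (card B))"
        unfolding card_partition_on_insert[OF that(1,2)] using that
        by (intro sum.cong refl IH) (auto intro: finite_subset simp flip: that(3) intro: card_mono)
      then show ?thesis
        using sum_Pow_card[OF that(1), of bell] that by simp
    qed
    have "card {P. partition_on A P} = card {P. partition_on (insert (Suc (card A')) {1..card A'}) P}"
      using rec[of A' x] rec[of "{1..card A'}" "Suc (card A')"] A fin by simp
    also have "insert (Suc (card A')) {1..card A'} = {1..card A}"
      using A fin by auto
    finally show ?thesis by (simp add: bell_def)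
  qed
qed

lemma bell_Suc: "bell (Suc n) = (\<Sum>k\<le>n. (n choose k) * bell k)"
proof -
  have "bell (Suc n) = card {P. partition_on (insert (Suc n) {1..n}) P}"
    by (simp add: bell_def atLeastAtMostSuc_conv)
  also have "\<dots> = (\<Sum>B\<in>Pow {1..n}. bell (card B))"
    by (subst card_partition_on_insert)
      (auto intro!: sum.cong card_partition_on intro: finite_subset)
  finally show ?thesis
    using sum_Pow_card[of "{1..n}" bell] by simp
qed

section \<open>Derangements and their one-term recurrence\<close>

definition derangements :: "'a set \<Rightarrow> ('a \<Rightarrow> 'a) set" where
  "derangements A = {\<pi>. \<pi> permutes A \<and> (\<forall>k\<in>A. \<pi> k \<noteq> k)}"

text \<open>Every permutation of \<open>A\<close> is a derangement of exactly one subset of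
  \<open>A\<close>, namely its set of moved points.\<close>

lemma sum_card_derangements:
  assumes "finite A"
  shows "(\<Sum>B\<in>Pow A. card (derangements B)) = fact (card A)"
proof -
  have "{\<pi>. \<pi> permutes A} = (\<Union>B\<in>Pow A. derangements B)"
  proof (intro equalityI subsetI)
    fix \<pi> assume "\<pi> \<in> {\<pi>. \<pi> permutes A}"
    then have pi: "\<pi> permutes A" by simp
    let ?B = "{x\<in>A. \<pi> x \<noteq> x}"
    have "\<pi> permutes ?B"
      using pi by (intro permutes_superset[OF pi]) (auto)
    then show "\<pi> \<in> (\<Union>B\<in>Pow A. derangements B)"
      by (intro UN_I[of ?B]) (auto simp: derangements_def)
  qed (auto simp: derangements_def intro: permutes_subset)
  then have "fact (card A) = card (\<Union>B\<in>Pow A. derangements B)"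
    using card_permutations[OF refl assms] by simp
  also have "\<dots> = (\<Sum>B\<in>Pow A. card (derangements B))"
  proof (intro card_UN_disjoint ballI impI)
    fix B assume "B \<in> Pow A"
    then have "finite {\<pi>. \<pi> permutes B}"
      using assms by (auto intro: finite_permutations finite_subset)
    then show "finite (derangements B)"
      by (rule finite_subset[rotated]) (auto simp: derangements_def)
  next
    fix B C :: "'a set" assume "B \<noteq> C"
    have "B = {x. \<pi> x \<noteq> x}" if "\<pi> \<in> derangements B" for \<pi> and B :: "'a set"
      using that by (auto simp: derangements_def permutes_def)
    then show "derangements B \<inter> derangements C = {}"
      using \<open>B \<noteq> C\<close> by blast
  qed (use assms in auto)
  finally show ?thesis ..
qed

text \<open>This form of the derangement recurrence is the one that the umbral values of
  \<open>shifted_ffact_poly\<close> satisfy up to sign.\<close>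

fun derangement_rec :: "nat \<Rightarrow> int" where
  "derangement_rec 0 = 1"
| "derangement_rec (Suc m) = int (Suc m) * derangement_rec m + (-1) ^ Suc m"

lemma sum_choose_derangement_rec:
  "(\<Sum>k\<le>m. int (m choose k) * derangement_rec k) = fact m"
proof (induction m)
  case (Suc m)
  have "(\<Sum>k\<le>Suc m. int (Suc m choose k) * derangement_rec k) =
      1 + (\<Sum>k\<le>m. int (Suc m choose Suc k) * derangement_rec (Suc k))"
    by (subst sum.atMost_Suc_shift) simp
  also have "\<dots> = 1 + (\<Sum>k\<le>m. int (Suc m) * (int (m choose k) * derangement_rec k)
      + (-1) ^ Suc k * int (Suc m choose Suc k))"
  proof (intro arg_cong2[of _ _ _ _ "(+)"] refl sum.cong)
    fix k
    \<comment> \<open>Absorption moves the factor \<open>Suc k\<close> of the recurrence onto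
      \<open>Suc m\<close>, so that the induction hypothesis applies; the leftover signs form a full
      alternating binomial sum, which vanishes.\<close>
    have "int (Suc k) * int (Suc m choose Suc k) = int (Suc m) * int (m choose k)"
      using Suc_times_binomial[of k m] by (metis of_nat_mult)
    then show "int (Suc m choose Suc k) * derangement_rec (Suc k) =
        int (Suc m) * (int (m choose k) * derangement_rec k) + (-1) ^ Suc k * int (Suc m choose Suc k)"
      unfolding derangement_rec.simps distrib_left mult.assoc[symmetric]
      by (simp only: mult.commute[of _ "int (Suc k)"] mult.commute[of _ "(-1) ^ Suc k"])
  qed
  also have "\<dots> = int (Suc m) * fact m + (\<Sum>k\<le>Suc m. (-1) ^ k * int (Suc m choose k))"
    unfolding sum.distrib sum_distrib_left[symmetric] Suc.IH
    by (subst sum.atMost_Suc_shift[of _ m]) simp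
  finally show ?case
    using choose_alternating_sum[of "Suc m", where 'a = int] by simp
qed auto

text \<open>Replaces binomial inversion: both sides have the same sum over all subsets of
  \<open>A\<close>, and they agree on proper subsets by induction, so the terms for \<open>A\<close>
  itself agree.\<close>

lemma card_derangements:
  assumes "finite A"
  shows "int (card (derangements A)) = derangement_rec (card A)"
  using assms
proof (induction "card A" arbitrary: A rule: less_induct)
  case less
  have "int (\<Sum>B\<in>Pow A. card (derangements B)) = (\<Sum>B\<in>Pow A. derangement_rec (card B))"
    using sum_card_derangements[OF less.prems] sum_Pow_card[OF less.prems, of derangement_rec]
      sum_choose_derangement_rec[of "card A"] by simp
  moreover have "(\<Sum>B\<in>Pow A - {A}. int (card (derangements B))) =
      (\<Sum>B\<in>Pow A - {A}. derangement_rec (card B))"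
    using less by (intro sum.cong refl less.hyps)
      (auto intro: finite_subset psubset_card_mono)
  ultimately show ?case
    using less.prems by (simp add: sum.remove[of "Pow A" A])
qed

lemma derangement_number_eq_rec: "int (derangement_number m) = derangement_rec m"
  using card_derangements[of "{1..m}"] by (simp add: derangements_def derangement_number_def)

section \<open>Frobenius and Fermat congruences, stated as divisibility by p\<close>

lemma freshmans_dream_dvd:
  fixes x y :: "'a::comm_ring_1"
  assumes "prime p"
  shows "of_nat p dvd (x + y) ^ p - (x ^ p + y ^ p)"
proof -
  have p: "p > 0" using assms by (simp add: prime_gt_0_nat)
  have "(x + y) ^ p = (\<Sum>k\<le>p. of_nat (p choose k) * x ^ k * y ^ (p - k))"
    by (rule binomial_ring)
  also have "\<dots> = x ^ p + y ^ p + (\<Sum>k\<in>{0<..<p}. of_nat (p choose k) * x ^ k * y ^ (p - k))"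
  proof -
    have "{..p} = insert 0 (insert p {0<..<p})" using p by auto
    then show ?thesis using p by (simp add: add_ac)
  qed
  finally have "(x + y) ^ p - (x ^ p + y ^ p) = (\<Sum>k\<in>{0<..<p}. of_nat (p choose k) * x ^ k * y ^ (p - k))"
    by simp
  also have "of_nat p dvd \<dots>"
  proof (intro dvd_sum dvd_mult2)
    fix k assume "k \<in> {0<..<p}"
    then have "p dvd (p choose k)"
      using assms by (intro dvd_choose_prime) auto
    then show "of_nat p dvd (of_nat (p choose k) :: 'a)"
      by (auto elim!: dvdE)
  qed
  finally show ?thesis .
qed

lemma dvd_power_diff_power:
  fixes x y d :: "'a::comm_ring_1"
  assumes "d dvd x - y"
  shows "d dvd x ^ n - y ^ n"
  using assms by (subst power_diff_sumr2) (rule dvd_mult2)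

lemma freshmans_dream_power_dvd:
  fixes x y :: "'a::comm_ring_1"
  assumes "prime p"
  shows "of_nat p dvd (x + y) ^ (p ^ a) - (x ^ (p ^ a) + y ^ (p ^ a))"
proof (induction a)
  case (Suc a)
  let ?q = "p ^ a"
  have "of_nat p dvd ((x + y) ^ ?q) ^ p - (x ^ ?q + y ^ ?q) ^ p"
    using Suc by (rule dvd_power_diff_power)
  moreover have "of_nat p dvd (x ^ ?q + y ^ ?q) ^ p - ((x ^ ?q) ^ p + (y ^ ?q) ^ p)"
    using assms by (rule freshmans_dream_dvd)
  ultimately have "of_nat p dvd (((x + y) ^ ?q) ^ p - (x ^ ?q + y ^ ?q) ^ p)
      + ((x ^ ?q + y ^ ?q) ^ p - ((x ^ ?q) ^ p + (y ^ ?q) ^ p))"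
    by (rule dvd_add)
  then show ?case
    by (simp only: power_mult[symmetric] mult.commute[of _ p] power_Suc add_diff_eq diff_add_cancel)
qed simp

lemma fermat_int_dvd:
  fixes t :: int
  assumes "prime p"
  shows "int p dvd t ^ (p ^ a) - t"
proof -
  have nat: "int p dvd int n ^ p - int n" for n
  proof (induction n)
    case (Suc n)
    have "int p dvd (int n + 1) ^ p - (int n ^ p + 1 ^ p) + (int n ^ p - int n)"
      using freshmans_dream_dvd[OF assms, of "int n" 1] Suc by (intro dvd_add) simp_all
    then show ?case by (simp add: algebra_simps)
  qed (use prime_gt_0_nat[OF assms] in \<open>simp add: power_0_left\<close>)
  have one: "int p dvd t ^ p - t" for t
  proof -
    \<comment> \<open>The induction only reaches natural numbers; a negative \<open>t\<close> is
      handled through its residue.\<close>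
    define n where "n = nat (t mod int p)"
    have n: "int p dvd t - int n"
      using assms by (simp add: n_def prime_gt_0_nat mod_eq_dvd_iff[symmetric])
    have "int p dvd (t ^ p - int n ^ p) + (int n ^ p - int n) - (t - int n)"
      by (rule dvd_diff[OF dvd_add[OF dvd_power_diff_power[OF n] nat] n])
    then show ?thesis by simp
  qed
  show ?thesis
  proof (induction a)
    case (Suc a)
    have "int p dvd ((t ^ (p ^ a)) ^ p - t ^ p) + (t ^ p - t)"
      using dvd_power_diff_power[OF Suc] one by (intro dvd_add)
    then show ?case by (simp add: power_mult[symmetric] mult.commute)
  qed simp
qed

section \<open>Falling factorial polynomials modulo p\<close>

definition ffact_poly :: "nat \<Rightarrow> int poly" where
  "ffact_poly n = (\<Prod>i<n. [:- int i, 1:])"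

lemma ffact_poly_0 [simp]: "ffact_poly 0 = 1"
  by (simp add: ffact_poly_def)

lemma ffact_poly_Suc: "ffact_poly (Suc n) = ffact_poly n * [:- int n, 1:]"
  by (simp add: ffact_poly_def)

lemma degree_ffact_poly: "degree (ffact_poly n) = n"
  unfolding ffact_poly_def by (subst degree_prod_eq_sum_degree) auto

lemma lead_coeff_ffact_poly: "coeff (ffact_poly n) n = 1"
proof -
  have "lead_coeff (ffact_poly n) = 1"
    unfolding ffact_poly_def lead_coeff_prod by simp
  then show ?thesis by (simp add: degree_ffact_poly)
qed

text \<open>Over the field with p elements, a polynomial has no more roots than its degree unless it
  is zero. The induction splits off the root \<open>m\<close>, with a remainder divisible by
  p.\<close>

lemma of_nat_dvd_poly_if_roots:
  fixes h :: "int poly"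
  assumes "prime p" "m \<le> p" "degree h < m" "\<And>j. j < m \<Longrightarrow> int p dvd poly h (int j)"
  shows "of_nat p dvd h"
  using assms(2-)
proof (induction m arbitrary: h)
  case (Suc m)
  define g where "g = synthetic_div h (int m)"
  have h: "h = [:- int m, 1:] * g + [:poly h (int m):]"
    unfolding g_def by (rule synthetic_div_correct'[symmetric])
  have hm: "int p dvd poly h (int m)"
    using Suc.prems by simp
  have "of_nat p dvd g"
  proof (cases "m = 0")
    case True
    then show ?thesis using Suc.prems by (simp add: g_def synthetic_div_eq_0_iff[THEN iffD2])
  next
    case False
    show ?thesis
    proof (rule Suc.IH)
      show "degree g < m"
        using Suc.prems False by (simp add: g_def degree_synthetic_div)
      fix j assume j: "j < m"
      have "int p dvd poly h (int j) - poly h (int m)"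
        using Suc.prems j by (intro dvd_diff) auto
      also have "poly h (int j) - poly h (int m) = (int j - int m) * poly g (int j)"
        by (subst (1) h) (simp add: algebra_simps)
      finally have "int p dvd int j - int m \<or> int p dvd poly g (int j)"
        using assms(1) by (simp add: prime_dvd_mult_iff)
      \<comment> \<open>The distance \<open>m - j\<close> is positive and below \<open>p\<close>,
        because \<open>Suc m \<le> p\<close>.\<close>
      moreover have "\<not> int p dvd int j - int m"
        using zdvd_imp_le[of "int p" "int m - int j"] j Suc.prems by (auto simp: dvd_diff_commute)
      ultimately show "int p dvd poly g (int j)" by blast
    qed (use Suc.prems in simp)
  qed
  moreover have "of_nat p dvd [:poly h (int m):]"
    using hm by (simp add: of_nat_poly)
  ultimately show ?case
    by (subst h) (intro dvd_add dvd_mult)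
qed simp

text \<open>The leading terms cancel, leaving degree below p, and by Fermat the difference vanishes
  modulo p at each of 0, ..., p-1.\<close>

lemma ffact_poly_prime_dvd:
  assumes "prime p"
  shows "of_nat p dvd monom 1 p - monom 1 1 - ffact_poly p"
proof (rule of_nat_dvd_poly_if_roots[OF assms order_refl])
  have p: "p > 1" using assms by (rule prime_gt_1_nat)
  show "degree (monom 1 p - monom 1 1 - ffact_poly p) < p"
  proof (rule degree_lessI)
    show "\<forall>k\<ge>p. coeff (monom 1 p - monom 1 1 - ffact_poly p) k = 0"
    proof (intro allI impI)
      fix k assume "k \<ge> p"
      then show "coeff (monom 1 p - monom 1 1 - ffact_poly p) k = 0"
        using p by (cases "k = p") (auto simp: lead_coeff_ffact_poly coeff_eq_0 degree_ffact_poly)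
    qed
  qed (use p in auto)
  fix j assume j: "j < p"
  have "poly (ffact_poly p) (int j) = 0"
    using j by (auto simp: ffact_poly_def poly_prod)
  then show "int p dvd poly (monom 1 p - monom 1 1 - ffact_poly p) (int j)"
    using fermat_int_dvd[OF assms, of "int j" 1] by (simp add: poly_monom)
qed

section \<open>The Bell functional, its shift rule and Touchard's congruence\<close>

definition bell_umbra :: "int poly \<Rightarrow> int" where
  "bell_umbra f = (\<Sum>i\<le>degree f. coeff f i * int (bell i))"

text \<open>Any common degree bound may serve as summation range, which makes linearity a termwise
  matter.\<close>

lemma bell_umbra_altdef:
  assumes "degree f \<le> N"
  shows "bell_umbra f = (\<Sum>i\<le>N. coeff f i * int (bell i))"
  unfolding bell_umbra_def using assms by (intro sum.mono_neutral_left) (auto simp: coeff_eq_0)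

lemma bell_umbra_0 [simp]: "bell_umbra 0 = 0"
  by (simp add: bell_umbra_def)

lemma bell_umbra_1 [simp]: "bell_umbra 1 = 1"
  by (simp add: bell_umbra_def bell_0)

lemma bell_umbra_add: "bell_umbra (f + g) = bell_umbra f + bell_umbra g"
proof -
  let ?N = "max (degree f) (degree g)"
  show ?thesis
    by (subst (1 2 3) bell_umbra_altdef[where N = ?N])
      (auto simp: degree_add_le sum.distrib algebra_simps)
qed

lemma bell_umbra_smult: "bell_umbra (smult c f) = c * bell_umbra f"
  by (subst (1 2) bell_umbra_altdef[where N = "degree f"])
    (auto simp: degree_smult_le sum_distrib_left mult.assoc)

lemma bell_umbra_diff: "bell_umbra (f - g) = bell_umbra f - bell_umbra g"
  using bell_umbra_add[of "f - g" g] by simp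

lemma bell_umbra_sum: "bell_umbra (sum f A) = (\<Sum>i\<in>A. bell_umbra (f i))"
  by (induction A rule: infinite_finite_induct) (auto simp: bell_umbra_add)

lemma bell_umbra_monom: "bell_umbra (monom c k) = c * int (bell k)"
  by (subst bell_umbra_altdef[OF degree_monom_le])
    (simp add: if_distrib[of "\<lambda>x. x * _"] cong: if_cong)

lemma bell_umbra_dvd:
  assumes "of_nat p dvd f"
  shows "int p dvd bell_umbra f"
  using assms by (auto simp: dvd_def of_nat_poly bell_umbra_smult)

lemma pcompose_power: "(f ^ n) \<circ>\<^sub>p g = (f \<circ>\<^sub>p g) ^ n" for f :: "'a::comm_semiring_1 poly"
  by (induction n) (simp_all add: pcompose_1 pcompose_mult)

text \<open>On the monomial of degree k, the binomial expansion of (x+1)^k turns the claim into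
  \<open>bell_Suc\<close>; linearity does the rest.\<close>

lemma bell_umbra_shift_1: "bell_umbra (f \<circ>\<^sub>p [:1, 1:]) = bell_umbra ([:0, 1:] * f)"
proof -
  have mon: "bell_umbra (monom 1 k \<circ>\<^sub>p [:1, 1:]) = bell_umbra (monom 1 (Suc k))" for k
  proof -
    have "monom 1 k \<circ>\<^sub>p [:1, 1:] = ([:0, 1:] + 1 :: int poly) ^ k"
      by (simp add: monom_altdef pcompose_power pcompose_pCons one_pCons)
    also have "\<dots> = (\<Sum>i\<le>k. monom (int (k choose i)) i)"
      by (subst binomial_ring) (simp add: of_nat_poly monom_altdef)
    finally show ?thesis
      by (simp add: bell_umbra_sum bell_umbra_monom bell_Suc)
  qed
  have f: "f = (\<Sum>i\<le>degree f. smult (coeff f i) (monom 1 i))"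
    by (subst poly_as_sum_of_monoms[of f, symmetric]) (simp add: smult_monom)
  have "bell_umbra (f \<circ>\<^sub>p [:1, 1:]) =
      (\<Sum>i\<le>degree f. coeff f i * bell_umbra (monom 1 i \<circ>\<^sub>p [:1, 1:]))"
    by (subst f) (simp add: pcompose_sum pcompose_smult bell_umbra_sum bell_umbra_smult)
  also have "\<dots> = (\<Sum>i\<le>degree f. coeff f i * bell_umbra ([:0, 1:] * monom 1 i))"
    unfolding mon by (simp add: monom_Suc)
  also have "\<dots> = bell_umbra ([:0, 1:] * f)"
    by (subst (3) f)
      (simp add: sum_distrib_left bell_umbra_sum bell_umbra_smult del: mult_pCons_left)
  finally show ?thesis .
qed

text \<open>Iterates the unit shift. The new factor x - n of \<open>ffact_poly (Suc n)\<close> is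
  absorbed into \<open>f\<close>, where shifting by n turns it into x; hence \<open>f\<close> is
  arbitrary in the induction.\<close>

lemma bell_umbra_shift: "bell_umbra (f \<circ>\<^sub>p [:int n, 1:]) = bell_umbra (ffact_poly n * f)"
proof (induction n arbitrary: f)
  case (Suc n)
  have "bell_umbra (ffact_poly (Suc n) * f) = bell_umbra (([:- int n, 1:] * f) \<circ>\<^sub>p [:int n, 1:])"
    by (simp only: ffact_poly_Suc Suc mult.assoc)
  also have "([:- int n, 1:] * f) \<circ>\<^sub>p [:int n, 1:] = [:0, 1:] * (f \<circ>\<^sub>p [:int n, 1:])"
    unfolding pcompose_mult by (simp add: pcompose_pCons)
  also have "bell_umbra \<dots> = bell_umbra (f \<circ>\<^sub>p [:int n, 1:] \<circ>\<^sub>p [:1, 1:])"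
    by (rule bell_umbra_shift_1[symmetric])
  also have "f \<circ>\<^sub>p [:int n, 1:] \<circ>\<^sub>p [:1, 1:] = f \<circ>\<^sub>p [:int (Suc n), 1:]"
    by (simp add: pcompose_assoc[symmetric] pcompose_pCons add_ac)
  finally show ?case ..
qed simp

lemma bell_umbra_ffact_poly: "bell_umbra (ffact_poly n) = 1"
  using bell_umbra_shift[of 1 n] by (simp add: pcompose_1)

text \<open>Shifting by p is the identity modulo p. With \<open>bell_umbra_shift\<close> this makes
  \<open>ffact_poly p\<close> act as 1 under the functional.\<close>

lemma of_nat_dvd_pcompose_shift: "of_nat p dvd f \<circ>\<^sub>p [:int p, 1:] - f"
proof (induction f)
  case (pCons c f)
  have "pCons c f \<circ>\<^sub>p [:int p, 1:] - pCons c f =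
      of_nat p * (f \<circ>\<^sub>p [:int p, 1:]) + [:0, 1:] * (f \<circ>\<^sub>p [:int p, 1:] - f)"
    by (simp add: pcompose_pCons of_nat_poly)
  then show ?case using pCons.IH by (simp only:) (intro dvd_add dvd_mult dvd_triv_left)
qed simp

text \<open>Touchard's congruence: \<open>x\<^sup>p = x + 1\<close> modulo the ideal of polynomials all of whose
  multiples have umbral value divisible by \<open>p\<close>; applying Frobenius gives the general case.\<close>

lemma bell_umbra_prime_power_dvd:
  assumes "prime p"
  shows "int p dvd bell_umbra ((monom 1 (p ^ a) - [:int a, 1:]) * f)"
proof (induction a arbitrary: f)
  case 0
  then show ?case by (simp add: monom_altdef)
next
  case (Suc a)
  let ?u = "monom 1 (p ^ a) :: int poly" and ?v = "[:int a, 1:] :: int poly"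
  \<comment> \<open>Cofactor in u^p - v^p = (u - v) w. The induction hypothesis will be used with
    \<open>w * f\<close> in place of \<open>f\<close>.\<close>
  define w where "w = (\<Sum>i<p. ?v ^ (p - Suc i) * ?u ^ i)"
  define d where "d = monom 1 p - monom 1 1 - ffact_poly p"
  have d: "of_nat p dvd d"
    unfolding d_def using assms by (rule ffact_poly_prime_dvd)
  have "of_nat p dvd ([:0, 1:] + [:int a:]) ^ p - ([:0, 1:] ^ p + [:int a:] ^ p :: int poly)"
    using assms by (rule freshmans_dream_dvd)
  moreover have "of_nat p dvd ([:int a:] ^ p - [:int a:] :: int poly)"
    using fermat_int_dvd[OF assms, of "int a" 1] by (simp add: of_nat_poly poly_const_pow)
  ultimately have "of_nat p dvd (([:0, 1:] + [:int a:]) ^ p - ([:0, 1:] ^ p + [:int a:] ^ p))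
      + ([:int a:] ^ p - [:int a:] :: int poly)"
    by (rule dvd_add)
  then have e: "of_nat p dvd ?v ^ p - (monom 1 p + [:int a:])" (is "_ dvd ?e")
    by (simp add: monom_altdef add_diff_eq diff_add_eq diff_diff_add[symmetric] del: diff_pCons)
  have w: "(?u - ?v) * w = monom 1 (p ^ Suc a) - ?v ^ p"
    unfolding w_def by (subst power_diff_sumr2[symmetric]) (simp add: monom_power mult.commute)
  have "[:int (Suc a), 1:] = [:int a:] + monom 1 1 + 1"
    by (simp add: monom_altdef one_pCons)
  \<comment> \<open>Telescoping from x^(p^(a+1)): the first term leads to v^p, \<open>?e\<close> to
    x^p + a, \<open>d\<close> to x + a plus the falling factorial, and the last term replaces that
    factorial by 1.\<close>
  then have "monom 1 (p ^ Suc a) - [:int (Suc a), 1:] =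
      (?u - ?v) * w + ?e + d + (ffact_poly p - 1)"
    unfolding w d_def by (simp only:)
  then have "bell_umbra ((monom 1 (p ^ Suc a) - [:int (Suc a), 1:]) * f) =
      bell_umbra ((?u - ?v) * (w * f)) + bell_umbra (?e * f) + bell_umbra (d * f)
      + bell_umbra (f \<circ>\<^sub>p [:int p, 1:] - f)"
    by (simp only: distrib_right bell_umbra_add left_diff_distrib bell_umbra_diff bell_umbra_shift
        mult.assoc mult_1)
  moreover have "int p dvd bell_umbra (?e * f)" "int p dvd bell_umbra (d * f)"
    using e d by (auto intro: bell_umbra_dvd)
  moreover have "int p dvd bell_umbra (f \<circ>\<^sub>p [:int p, 1:] - f)"
    by (intro bell_umbra_dvd of_nat_dvd_pcompose_shift)
  ultimately show ?case
    using Suc.IH[of "w * f"] by (simp only: dvd_add)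
qed

section \<open>Derangement numbers as umbral values, and the value of the shifted power\<close>

definition shifted_ffact_poly :: "nat \<Rightarrow> int poly" where
  "shifted_ffact_poly m = (\<Prod>i<m. [:- int (Suc i), 1:])"

lemma ffact_poly_Suc_shifted: "ffact_poly (Suc m) = [:0, 1:] * shifted_ffact_poly m"
  unfolding ffact_poly_def shifted_ffact_poly_def by (subst prod.lessThan_Suc_shift) simp

text \<open>Splitting the last factor as x - (m+1) gives \<open>ffact_poly (Suc m)\<close>, of value
  1, minus m+1 times the previous polynomial. This is the derangement recurrence with alternating
  signs.\<close>

lemma bell_umbra_shifted_ffact_poly:
  "bell_umbra (shifted_ffact_poly m) = (-1) ^ m * int (derangement_number m)"
proof (induction m)
  case (Suc m)
  have "shifted_ffact_poly (Suc m) = shifted_ffact_poly m * [:- int (Suc m), 1:]"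
    by (simp add: shifted_ffact_poly_def)
  also have "\<dots> = ffact_poly (Suc m) - smult (int (Suc m)) (shifted_ffact_poly m)"
    by (simp add: ffact_poly_Suc_shifted smult_add_left smult_diff_left)
  finally have "bell_umbra (shifted_ffact_poly (Suc m)) =
      1 - int (Suc m) * bell_umbra (shifted_ffact_poly m)"
    by (simp only: bell_umbra_diff bell_umbra_smult bell_umbra_ffact_poly)
  then show ?case
    by (simp add: Suc derangement_number_eq_rec algebra_simps)
qed (simp add: shifted_ffact_poly_def derangement_number_0)

lemma bell_umbra_shifted_power:
  assumes "prime p" "n > 0"
  shows "int p dvd bell_umbra ([:int n, 1:] ^ (p ^ a - 1))
    - (1 + int a * (-1) ^ (n - 1) * int (derangement_number (n - 1)))"
proof -
  obtain m where n: "n = Suc m" using assms by (cases n) auto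
  have q: "Suc (p ^ a - 1) = p ^ a" using assms by (simp add: prime_gt_0_nat)
  have "bell_umbra ([:int n, 1:] ^ (p ^ a - 1)) = bell_umbra (monom 1 (p ^ a - 1) \<circ>\<^sub>p [:int n, 1:])"
    by (simp add: monom_altdef pcompose_power pcompose_pCons)
  also have "\<dots> = bell_umbra (ffact_poly n * monom 1 (p ^ a - 1))"
    by (rule bell_umbra_shift)
  \<comment> \<open>The factor x of \<open>ffact_poly n\<close> raises the exponent from p^a - 1 to
    p^a, where Touchard's congruence applies.\<close>
  also have "ffact_poly n * monom 1 (p ^ a - 1) =
      monom 1 (Suc (p ^ a - 1)) * shifted_ffact_poly m"
    unfolding n ffact_poly_Suc_shifted monom_Suc by simp
  also have "\<dots> = (monom 1 (p ^ a) - [:int a, 1:]) * shifted_ffact_poly m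
      + (ffact_poly n + smult (int a) (shifted_ffact_poly m))"
    unfolding q n ffact_poly_Suc_shifted by (simp add: algebra_simps)
  finally show ?thesis
    using bell_umbra_prime_power_dvd[OF assms(1), of a "shifted_ffact_poly m"]
    by (simp add: bell_umbra_add bell_umbra_smult bell_umbra_ffact_poly
        bell_umbra_shifted_ffact_poly n mult.assoc)
qed

section \<open>The geometric sum modulo p and the congruence over the integers\<close>

text \<open>After multiplication by x - t both sides become x^q - t^q modulo p, with q = p^a. The
  factor cancels because p is a prime element of the integer polynomials and does not divide the
  monic x - t.\<close>

lemma geometric_sum_poly_dvd:
  fixes t :: int
  assumes "prime p"
  shows "of_nat p dvd (\<Sum>i<p ^ a. monom (t ^ (p ^ a - Suc i)) i) - [:- t, 1:] ^ (p ^ a - 1)"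
proof -
  let ?q = "p ^ a"
  let ?G = "\<Sum>i<?q. monom (t ^ (?q - Suc i)) i"
  have q: "?q = Suc (?q - 1)" using assms by (simp add: prime_gt_0_nat)
  have "[:- t, 1:] * ?G = ([:0, 1:] - [:t:]) * (\<Sum>i<?q. [:t:] ^ (?q - Suc i) * [:0, 1:] ^ i)"
    by (simp add: monom_altdef poly_const_pow)
  also have "\<dots> = [:0, 1:] ^ ?q - [:t:] ^ ?q"
    by (rule power_diff_sumr2[symmetric])
  finally have G: "[:- t, 1:] * ?G = [:0, 1:] ^ ?q - [:t:] ^ ?q" .
  have "of_nat p dvd ([:0, 1:] + [:- t:]) ^ ?q - ([:0, 1:] ^ ?q + [:- t:] ^ ?q)"
    using assms by (rule freshmans_dream_power_dvd)
  \<comment> \<open>Fermat at both t and -t gives (-t)^q + t^q = 0 modulo p without a case split on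
    the parity of q.\<close>
  moreover have "int p dvd ((- t) ^ ?q - (- t)) + (t ^ ?q - t)"
    using assms by (intro dvd_add fermat_int_dvd)
  then have "of_nat p dvd [:- t:] ^ ?q + [:t:] ^ ?q"
    by (simp add: of_nat_poly poly_const_pow)
  ultimately have "of_nat p dvd (([:0, 1:] + [:- t:]) ^ ?q - ([:0, 1:] ^ ?q + [:- t:] ^ ?q))
      + ([:- t:] ^ ?q + [:t:] ^ ?q)"
    by (rule dvd_add)
  also have "\<dots> = [:- t, 1:] ^ ?q - [:- t, 1:] * ?G"
    unfolding G by simp
  also have "\<dots> = [:- t, 1:] * ([:- t, 1:] ^ (?q - 1) - ?G)"
    by (subst (1) q) (simp only: power_Suc right_diff_distrib)
  finally have "[:int p:] dvd [:- t, 1:] * ([:- t, 1:] ^ (?q - 1) - ?G)"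
    by (simp add: of_nat_poly)
  moreover have "prime_elem [:int p:]"
    using assms by (simp add: prime_elem_const_poly_iff)
  moreover have "\<not> [:int p:] dvd [:- t, 1:]"
  proof
    assume "[:int p:] dvd [:- t, 1:]"
    then have "int p dvd coeff [:- t, 1:] 1"
      unfolding const_poly_dvd_iff by blast
    then show False using prime_gt_1_nat[OF assms] by simp
  qed
  ultimately have "[:int p:] dvd [:- t, 1:] ^ (?q - 1) - ?G"
    by (simp only: prime_elem_dvd_mult_iff) simp
  then have "of_nat p dvd - ([:- t, 1:] ^ (?q - 1) - ?G)"
    by (simp only: of_nat_poly dvd_minus_iff)
  then show ?thesis
    by (simp only: minus_diff_eq)
qed

text \<open>The target congruence with denominators cleared by (-n)^(q-1), where q = p^a. The umbral
  sum also contains the term k = 0, which is 1 modulo p and cancels the 1 in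
  \<open>bell_umbra_shifted_power\<close>.\<close>

lemma bell_sum_dvd:
  assumes "prime p" "n > 0" "\<not> p dvd n"
  shows "int p dvd (\<Sum>k=1..p ^ a - 1. int (bell k) * (- int n) ^ (p ^ a - 1 - k))
    - int a * (-1) ^ (n - 1) * int (derangement_number (n - 1)) * (- int n) ^ (p ^ a - 1)"
    (is "_ dvd ?S - ?y * ?t ^ (?q - 1)")
proof -
  have q: "?q = Suc (?q - 1)" using assms by (simp add: prime_gt_0_nat)
  have "bell_umbra (\<Sum>i<?q. monom (?t ^ (?q - Suc i)) i) =
      (\<Sum>i<?q. int (bell i) * ?t ^ (?q - 1 - i))"
    by (simp add: bell_umbra_sum bell_umbra_monom mult.commute)
  also have "\<dots> = (\<Sum>i\<in>insert 0 {1..?q - 1}. int (bell i) * ?t ^ (?q - 1 - i))"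
    using prime_gt_0_nat[OF assms(1)]
    by (intro sum.cong) (auto simp: less_eq_Suc_le[symmetric] simp flip: less_Suc_eq_le)
  finally have G: "bell_umbra (\<Sum>i<?q. monom (?t ^ (?q - Suc i)) i) = ?t ^ (?q - 1) + ?S"
    by (simp add: bell_0)
  \<comment> \<open>Fermat's congruence with one factor \<open>?t\<close> split off; it can be
    cancelled since p does not divide n.\<close>
  have "int p dvd ?t * (?t ^ (?q - 1) - 1)"
    using fermat_int_dvd[OF assms(1), of ?t a] q
    by (metis mult.right_neutral power_Suc right_diff_distrib)
  then have t: "int p dvd ?t ^ (?q - 1) - 1"
    using assms by (auto simp: prime_dvd_mult_iff)
  have "int p dvd ?t ^ (?q - 1) + ?S - bell_umbra ([:int n, 1:] ^ (?q - 1))"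
    using bell_umbra_dvd[OF geometric_sum_poly_dvd[OF assms(1), of ?t a]]
    by (simp add: bell_umbra_diff G)
  from dvd_diff[OF dvd_add[OF this bell_umbra_shifted_power[OF assms(1,2), of a]] dvd_mult[OF t]]
  have "int p dvd (?t ^ (?q - 1) + ?S - bell_umbra ([:int n, 1:] ^ (?q - 1)))
      + (bell_umbra ([:int n, 1:] ^ (?q - 1)) - (1 + ?y)) - ?y * (?t ^ (?q - 1) - 1)
      - (?t ^ (?q - 1) - 1)"
    using t by (rule dvd_diff)
  also have "\<dots> = ?S - ?y * ?t ^ (?q - 1)"
    by (simp add: algebra_simps)
  finally show ?thesis .
qed

section \<open>Passage from integers to p-integral rationals\<close>

text \<open>The reduced denominator divides every denominator of the same fraction, so it inherits
  coprimality to p from \<open>v\<close>.\<close>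

lemma p_integral_divide:
  assumes "coprime v (int p)" "v \<noteq> 0"
  shows "p_integral p (of_int u / of_int v)"
proof -
  obtain r s where rs: "quotient_of (of_int u / of_int v) = (r, s)" by fastforce
  have s: "s > 0" "coprime r s"
    using quotient_of_denom_pos[OF rs] quotient_of_coprime[OF rs] by auto
  have "of_int u / of_int v = (of_int r / of_int s :: rat)"
    using quotient_of_div[OF rs] .
  then have "of_int (u * s) = (of_int (r * v) :: rat)"
    using s assms by (simp add: field_simps)
  then have "u * s = r * v" by (simp only: of_int_eq_iff)
  then have "s dvd v"
    using s by (metis coprime_commute coprime_dvd_mult_right_iff dvd_triv_right)
  then have "coprime s (int p)"
    using coprime_divisors[OF _ dvd_refl assms(1)] by blast
  then show ?thesis
    using rs by (simp add: p_integral_def)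
qed

theorem theorem1p1:
  fixes p a n :: nat
  assumes "prime p" and "a > 0" and "n > 0" and "\<not> p dvd n"
  shows "padic_cong p
    (\<Sum>k = 1..p ^ a - 1. of_nat (bell k) / (- of_nat n) ^ k)
    (of_nat a * (- 1) ^ (n - 1) * of_nat (derangement_number (n - 1)))"
proof -
  define q t y where "q = p ^ a" and "t = - int n"
    and "y = int a * (-1) ^ (n - 1) * int (derangement_number (n - 1))"
  define S where "S = (\<Sum>k=1..q - 1. int (bell k) * t ^ (q - 1 - k))"
  \<comment> \<open>Common denominator of the sum; it is a power of -n, hence prime to p, and the
    quotient by p of the difference is \<open>c\<close> over \<open>v\<close>.\<close>
  define v where "v = t ^ (q - 1)"
  have t: "t \<noteq> 0" and v: "v \<noteq> 0" using assms by (auto simp: t_def v_def)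
  have cop: "coprime v (int p)"
    using assms prime_imp_coprime[of p n] by (simp add: v_def t_def coprime_commute)
  obtain c where c: "S - y * v = int p * c"
    using bell_sum_dvd[OF assms(1,3,4), of a]
    unfolding S_def y_def v_def t_def q_def dvd_def by blast
  have "(\<Sum>k = 1..q - 1. of_nat (bell k) / (- of_nat n) ^ k) = (of_int S / of_int v :: rat)"
    unfolding S_def of_int_sum sum_divide_distrib
  proof (intro sum.cong refl)
    fix k assume "k \<in> {1..q - 1}"
    then have "q - 1 = (q - 1 - k) + k"
      by (simp only: atLeastAtMost_iff le_add_diff_inverse2)
    then have "v = t ^ (q - 1 - k) * t ^ k"
      unfolding v_def by (metis power_add)
    then show "of_nat (bell k) / (- of_nat n) ^ k =
        (of_int (int (bell k) * t ^ (q - 1 - k)) / of_int v :: rat)"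
      using t by (simp add: t_def)
  qed
  moreover have "of_int S / of_int v - of_int y = of_nat p * (of_int c / of_int v :: rat)"
  proof -
    have "of_int S - of_int y * of_int v = (of_nat p * of_int c :: rat)"
      using arg_cong[OF c, of "of_int :: int \<Rightarrow> rat"] by simp
    then show ?thesis using v by (simp add: field_simps)
  qed
  moreover have "p_integral p (of_int y)"
    using p_integral_divide[of 1 p y] by simp
  ultimately have "padic_cong p (\<Sum>k = 1..q - 1. of_nat (bell k) / (- of_nat n) ^ k) (of_int y)"
    using p_integral_divide[OF cop v] by (auto simp: padic_cong_def simp del: times_divide_eq_right)
  then show ?thesis by (simp add: q_def y_def)
qed

end
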